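(* Let $W$ be an $\omega$-Stone space, $P$ a PO system and $\mathscr{X}$ a complete $P$-partition of $W$. Then $\mathscr{X}$ is a rank $P$-partition of $W$ iff $\mathscr{X}$ is strongly semi-trim and all elements of $\widehat{P}$ are compact in $P$.
   Context: A PO system is a set $P$ with an antisymmetric transitive relation $<$ (possibly $p<p$ for some $p$); $p\leqslant q$ means $p<q$ or $p=q$; $p\lneqq q$ means $p\leqslant q$ and $p\neq q$; $P^{d}=\{p\in P: p\nless p\}$; $p_{\uparrow}=\{q\in P: q\geqslant p\}$. Suprema are with respect to $\leqslant$, and strictly increasing means strictly increasing with respect to $\lneqq$. An ideal of $P$ is a non-empty lower subset $J$ (closed downward under $\leqslant$) such that any $x,y\in J$ have a common upper bound $z\in J$. An element $p\in P$ is separated (in $P$) if it is not the supremum of a strictly increasing sequence in $P$; $p$ is compact in $P$ if for every ideal $J$ of $P$ with $p\leqslant\sup_P J$ (the supremum existing), we have $p\in J$. An $\omega$-Stone space $W$ is a locally compact Hausdorff space with a base of compact open sets, having only countably many compact open subsets (the Stone space of a countable Boolean ring, possibly without $1$). A complete $P$-partition $\mathscr{X}=\{X_p\mid p\in P\}$ of $W$ is a partition of $W$ into non-empty sets $X_p$ with $X_p'=\bigcup_{q<p}X_q$ for all $p\in P$, where $S'$ is the set of limit points of $S$. The label function $\tau\colon W\to P$ is given by $\tau(w)=p$ for $w\in X_p$. A compact open $A$ is $p$-trim if $\{q: A\cap X_q\neq\emptyset\}=p_{\uparrow}$ and, if $p\in P^d$, also $|A\cap X_p|=1$; a set is trim if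 it is $p$-trim for some $p$; $\widehat{P}$ is the set of $p$ for which there is a $p$-trim set. A point $w$ is clean if $w\in X_p$ for some $p$ and $w$ has a $p$-trim neighbourhood. $\mathscr{X}$ is strongly semi-trim if: (T1) every element of $W$ has a neighbourhood base of trim sets; (T2) for each $p\in\widehat P$, every element of $W$ with a neighbourhood base of $p$-trim sets lies in $X_p$; (SST3) all points in $X_p$ are clean for $p\in\widehat P$. The complete $P$-partition $\mathscr{X}$ is a rank $P$-partition if: (RP1) if $q$ is separated, $x=\lim x_k$, $\tau(x)\geqslant q$ and $\{\tau(x_k)\mid k\geqslant1\}$ are either pairwise strictly incomparable or strictly increasing, then $\tau(x_k)\geqslant q$ for almost all $k$ (all but finitely many); (RP2) if $\tau(x)$ is not separated, then we can write $x=\lim x_k$ with $\tau(x_k)\lneqq\tau(x)$ for all $k$. *)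

theory Defs
  imports "HOL-Analysis.Analysis"
begin

section \<open>PO systems\<close>

text \<open>
  A PO system is a carrier \<^term>\<open>P\<close> with an antisymmetric and transitive relation \<^term>\<open>lt\<close>
  which may hold on some, all or no diagonal pairs.
\<close>

definition po_system :: "'p set \<Rightarrow> ('p \<Rightarrow> 'p \<Rightarrow> bool) \<Rightarrow> bool" where
  "po_system P lt \<longleftrightarrow> antisymp_on P lt \<and> transp_on P lt"

abbreviation po_le :: "('p \<Rightarrow> 'p \<Rightarrow> bool) \<Rightarrow> 'p \<Rightarrow> 'p \<Rightarrow> bool" where
  "po_le lt \<equiv> reflclp lt"

definition po_less :: "('p \<Rightarrow> 'p \<Rightarrow> bool) \<Rightarrow> 'p \<Rightarrow> 'p \<Rightarrow> bool" where
  "po_less lt p q \<longleftrightarrow> po_le lt p q \<and> p \<noteq> q"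

definition discrete_part :: "'p set \<Rightarrow> ('p \<Rightarrow> 'p \<Rightarrow> bool) \<Rightarrow> 'p set" where
  "discrete_part P lt = {p \<in> P. \<not> lt p p}"

definition upset :: "'p set \<Rightarrow> ('p \<Rightarrow> 'p \<Rightarrow> bool) \<Rightarrow> 'p \<Rightarrow> 'p set" where
  "upset P lt p = {q \<in> P. po_le lt p q}"

definition is_po_sup :: "'p set \<Rightarrow> ('p \<Rightarrow> 'p \<Rightarrow> bool) \<Rightarrow> 'p set \<Rightarrow> 'p \<Rightarrow> bool" where
  "is_po_sup P lt S s \<longleftrightarrow>
     s \<in> P \<and> (\<forall>x\<in>S. po_le lt x s) \<and> (\<forall>u\<in>P. (\<forall>x\<in>S. po_le lt x u) \<longrightarrow> po_le lt s u)"

definition po_ideal :: "'p set \<Rightarrow> ('p \<Rightarrow> 'p \<Rightarrow> bool) \<Rightarrow> 'p set \<Rightarrow> bool" where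
  "po_ideal P lt J \<longleftrightarrow>
     J \<subseteq> P \<and> J \<noteq> {} \<and> (\<forall>x\<in>J. \<forall>y\<in>P. po_le lt y x \<longrightarrow> y \<in> J) \<and>
     (\<forall>x\<in>J. \<forall>y\<in>J. \<exists>z\<in>J. po_le lt x z \<and> po_le lt y z)"

definition strictly_increasing :: "('p \<Rightarrow> 'p \<Rightarrow> bool) \<Rightarrow> (nat \<Rightarrow> 'p) \<Rightarrow> bool" where
  "strictly_increasing lt s \<longleftrightarrow> monotone (<) (po_less lt) s"

definition pairwise_incomparable :: "('p \<Rightarrow> 'p \<Rightarrow> bool) \<Rightarrow> (nat \<Rightarrow> 'p) \<Rightarrow> bool" where
  "pairwise_incomparable lt s \<longleftrightarrow> (\<forall>i j. i \<noteq> j \<longrightarrow> \<not> po_le lt (s i) (s j))"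

definition separated_in :: "'p set \<Rightarrow> ('p \<Rightarrow> 'p \<Rightarrow> bool) \<Rightarrow> 'p \<Rightarrow> bool" where
  "separated_in P lt p \<longleftrightarrow>
     \<not> (\<exists>s. range s \<subseteq> P \<and> strictly_increasing lt s \<and> is_po_sup P lt (range s) p)"

definition po_compact :: "'p set \<Rightarrow> ('p \<Rightarrow> 'p \<Rightarrow> bool) \<Rightarrow> 'p \<Rightarrow> bool" where
  "po_compact P lt p \<longleftrightarrow>
     (\<forall>J s. po_ideal P lt J \<and> is_po_sup P lt J s \<and> po_le lt p s \<longrightarrow> p \<in> J)"

section \<open>Omega-Stone spaces and complete partitions\<close>

definition omega_Stone_space :: "'w topology \<Rightarrow> bool" where
  "omega_Stone_space W \<longleftrightarrow>
     locally_compact_space W \<and> Hausdorff_space W \<and>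
     openin W = arbitrary union_of (\<lambda>A. compactin W A \<and> openin W A) \<and>
     countable {A. compactin W A \<and> openin W A}"

definition complete_partition ::
    "'w topology \<Rightarrow> 'p set \<Rightarrow> ('p \<Rightarrow> 'p \<Rightarrow> bool) \<Rightarrow> ('p \<Rightarrow> 'w set) \<Rightarrow> bool" where
  "complete_partition W P lt X \<longleftrightarrow>
     (\<Union>p\<in>P. X p) = topspace W \<and> disjoint_family_on X P \<and> (\<forall>p\<in>P. X p \<noteq> {}) \<and>
     (\<forall>p\<in>P. W derived_set_of (X p) = (\<Union>q\<in>{q \<in> P. lt q p}. X q))"

definition label :: "'p set \<Rightarrow> ('p \<Rightarrow> 'w set) \<Rightarrow> 'w \<Rightarrow> 'p" where
  "label P X w = (THE p. p \<in> P \<and> w \<in> X p)"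

lemma label_eq:
  assumes "complete_partition W P lt X" "p \<in> P" "w \<in> X p"
  shows "label P X w = p"
  unfolding label_def
proof (rule the_equality)
  show "p \<in> P \<and> w \<in> X p" using assms by simp
  show "q = p" if "q \<in> P \<and> w \<in> X q" for q
    using that assms unfolding complete_partition_def disjoint_family_on_def by blast
qed

section \<open>Trim sets and strongly semi-trim partitions\<close>

definition p_trim ::
    "'w topology \<Rightarrow> 'p set \<Rightarrow> ('p \<Rightarrow> 'p \<Rightarrow> bool) \<Rightarrow> ('p \<Rightarrow> 'w set) \<Rightarrow> 'p \<Rightarrow> 'w set \<Rightarrow> bool" where
  "p_trim W P lt X p A \<longleftrightarrow>
     compactin W A \<and> openin W A \<and> {q \<in> P. A \<inter> X q \<noteq> {}} = upset P lt p \<and>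
     (p \<in> discrete_part P lt \<longrightarrow> card (A \<inter> X p) = 1)"

definition trim ::
    "'w topology \<Rightarrow> 'p set \<Rightarrow> ('p \<Rightarrow> 'p \<Rightarrow> bool) \<Rightarrow> ('p \<Rightarrow> 'w set) \<Rightarrow> 'w set \<Rightarrow> bool" where
  "trim W P lt X A \<longleftrightarrow> (\<exists>p\<in>P. p_trim W P lt X p A)"

definition trim_labels ::
    "'w topology \<Rightarrow> 'p set \<Rightarrow> ('p \<Rightarrow> 'p \<Rightarrow> bool) \<Rightarrow> ('p \<Rightarrow> 'w set) \<Rightarrow> 'p set" where
  "trim_labels W P lt X = {p \<in> P. \<exists>A. p_trim W P lt X p A}"

text \<open>As trim sets are open, a trim neighbourhood of a point is a trim set containing it.\<close>

definition clean ::
    "'w topology \<Rightarrow> 'p set \<Rightarrow> ('p \<Rightarrow> 'p \<Rightarrow> bool) \<Rightarrow> ('p \<Rightarrow> 'w set) \<Rightarrow> 'w \<Rightarrow> bool" where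
  "clean W P lt X w \<longleftrightarrow> (\<exists>p\<in>P. w \<in> X p \<and> (\<exists>A. p_trim W P lt X p A \<and> w \<in> A))"

definition strongly_semi_trim ::
    "'w topology \<Rightarrow> 'p set \<Rightarrow> ('p \<Rightarrow> 'p \<Rightarrow> bool) \<Rightarrow> ('p \<Rightarrow> 'w set) \<Rightarrow> bool" where
  "strongly_semi_trim W P lt X \<longleftrightarrow>
     (\<forall>w\<in>topspace W. neighbourhood_base_at w (trim W P lt X) W) \<and>
     (\<forall>p\<in>trim_labels W P lt X. \<forall>w\<in>topspace W.
        neighbourhood_base_at w (p_trim W P lt X p) W \<longrightarrow> w \<in> X p) \<and>
     (\<forall>p\<in>trim_labels W P lt X. \<forall>w\<in>X p. clean W P lt X w)"

section \<open>Rank partitions\<close>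

text \<open>
  Only the two rank conditions; completeness of the partition is a separate hypothesis.
  Incomparability is imposed on the sequence of labels, so in that case its terms are distinct.
  Allowing repetitions would give the same condition: if infinitely many \<^term>\<open>x k\<close> lie in one
  set \<^term>\<open>X p\<close>, their limit has label below \<^term>\<open>p\<close>.
\<close>

definition rank_partition ::
    "'w topology \<Rightarrow> 'p set \<Rightarrow> ('p \<Rightarrow> 'p \<Rightarrow> bool) \<Rightarrow> ('p \<Rightarrow> 'w set) \<Rightarrow> bool" where
  "rank_partition W P lt X \<longleftrightarrow>
     (\<forall>q\<in>P. \<forall>x y.
        separated_in P lt q \<and> range x \<subseteq> topspace W \<and> limitin W x y sequentially \<and>
        po_le lt q (label P X y) \<and>
        (pairwise_incomparable lt (\<lambda>k. label P X (x k)) \<or>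
         strictly_increasing lt (\<lambda>k. label P X (x k)))
        \<longrightarrow> (\<forall>\<^sub>F k in sequentially. po_le lt q (label P X (x k)))) \<and>
     (\<forall>y\<in>topspace W. \<not> separated_in P lt (label P X y) \<longrightarrow>
        (\<exists>x. range x \<subseteq> topspace W \<and> limitin W x y sequentially \<and>
             (\<forall>k. po_less lt (label P X (x k)) (label P X y))))"

end

theory Submission
  imports Defs "HOL-Library.Ramsey"
begin

text \<open>
  Both properties say that the sets \<open>{w. q \<preceq> \<tau> w}\<close>, where \<open>\<tau>\<close> is the label function, are open
  for the right labels \<open>q\<close>, and in both cases the right labels turn out to be the separated ones,
  which are also the trim labels. Completeness means that the closure of \<open>X p\<close> consists of the
  points labelled below \<open>p\<close>; so labels can only drop in a limit from a single \<open>X p\<close>, and the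
  labels met by an open set form an upper set.

  Let the partition be a rank partition. By Ramsey's theorem a sequence has a subsequence whose
  labels are bounded by the first one, strictly increasing, or pairwise incomparable. The bound
  passes to the limit, and the first rank condition deals with the other two types, so
  \<open>{w. q \<preceq> \<tau> w}\<close> is open for each separated \<open>q\<close> (\<open>openin_labels_above_separated\<close>). By Zorn's
  lemma each label met by a compact open set lies above a minimal one
  (\<open>minimal_label_in_compact\<close>), and the second rank condition forces minimal labels to be
  separated. Trim neighbourhoods are then glued from a neighbourhood of the given point and one of
  a point of minimal label. For compactness of a trim label \<open>p\<close> in \<open>P\<close>, replace an ideal with
  supremum above \<open>p\<close> by its trim labels. They are countably many and directed, so a strictly
  increasing sequence has the same supremum unless they contain it. Points of nested trim sets
  realise such a sequence by a convergent sequence with limit labelled by the supremum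
  (\<open>converging_points_with_increasing_labels\<close>), and the first rank condition puts \<open>p\<close> below a
  member of the ideal.

  Conversely, if trim sets form a base, the label of each point is the directed supremum of the
  least labels of its trim neighbourhoods (\<open>sup_trim_labels_at\<close>). If \<open>q\<close> is compact in \<open>P\<close>, one of
  these least labels is already above \<open>q\<close>, so \<open>{w. q \<preceq> \<tau> w}\<close> is open
  (\<open>openin_labels_above_compact\<close>). A separated label belongs to its own directed set and is
  therefore a trim label, which gives the first rank condition. A label that is not separated is
  not compact in \<open>P\<close>, hence not a trim label, so points that attain the least labels of shrinking
  trim neighbourhoods give the second.
\<close>

section \<open>Sequences and suprema in PO systems\<close>

locale po =
  fixes P :: "'p set" and lt :: "'p \<Rightarrow> 'p \<Rightarrow> bool"
  assumes po: "po_system P lt"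
begin

text \<open>
  An opaque name for the reflexive closure, which proof search would otherwise split into
  the disjunction of \<^term>\<open>lt\<close> and equality.
\<close>

definition le :: "'p \<Rightarrow> 'p \<Rightarrow> bool" (infix "\<preceq>" 50) where
  "le = po_le lt"

lemma le_iff: "a \<preceq> b \<longleftrightarrow> lt a b \<or> a = b"
  by (auto simp: le_def)

lemma le_refl [simp]: "a \<preceq> a"
  by (simp add: le_iff)

lemma le_trans:
  assumes "a \<preceq> b" "b \<preceq> c" "a \<in> P" "b \<in> P" "c \<in> P"
  shows "a \<preceq> c"
  using assms po unfolding po_system_def le_iff by (meson transp_onD)

lemma le_antisym:
  assumes "a \<preceq> b" "b \<preceq> a" "a \<in> P" "b \<in> P"
  shows "a = b"
  using assms po unfolding po_system_def le_iff by (meson antisymp_onD)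

lemma po_less_iff: "po_less lt a b \<longleftrightarrow> a \<preceq> b \<and> a \<noteq> b"
  by (simp add: po_less_def le_def)

lemma sup_iff:
  "is_po_sup P lt S s \<longleftrightarrow>
     s \<in> P \<and> (\<forall>x\<in>S. x \<preceq> s) \<and> (\<forall>u\<in>P. (\<forall>x\<in>S. x \<preceq> u) \<longrightarrow> s \<preceq> u)"
  by (simp add: is_po_sup_def le_def)

lemma ideal_iff:
  "po_ideal P lt J \<longleftrightarrow> J \<subseteq> P \<and> J \<noteq> {} \<and> (\<forall>x\<in>J. \<forall>y\<in>P. y \<preceq> x \<longrightarrow> y \<in> J) \<and>
     (\<forall>x\<in>J. \<forall>y\<in>J. \<exists>z\<in>J. x \<preceq> z \<and> y \<preceq> z)"
  by (simp add: po_ideal_def le_def)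

lemma upset_iff: "q \<in> upset P lt p \<longleftrightarrow> q \<in> P \<and> p \<preceq> q"
  by (simp add: upset_def le_def)

lemma incomparable_iff:
  "pairwise_incomparable lt s \<longleftrightarrow> (\<forall>i j. i \<noteq> j \<longrightarrow> \<not> s i \<preceq> s j)"
  by (simp add: pairwise_incomparable_def le_def)

lemma strictly_increasing_less:
  assumes "strictly_increasing lt s" "i < j"
  shows "s i \<preceq> s j" "s i \<noteq> s j"
  using assms by (auto simp: strictly_increasing_def monotone_def po_less_iff)

lemma strictly_increasing_le:
  assumes "strictly_increasing lt s" "i \<le> j"
  shows "s i \<preceq> s j"
  using assms strictly_increasing_less by (cases "i = j") auto

lemma strictly_increasing_subseq:
  assumes "strictly_increasing lt s" "strict_mono r"
  shows "strictly_increasing lt (\<lambda>i. s (r i))"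
  using assms by (simp add: strictly_increasing_def monotone_def)

lemma strictly_increasingI:
  assumes inP: "\<And>n. s n \<in> P" and step: "\<And>n. s n \<preceq> s (Suc n)" "\<And>n. s n \<noteq> s (Suc n)"
  shows "strictly_increasing lt s"
proof -
  have mono: "s i \<preceq> s j" if "i \<le> j" for i j
    using that by (induction rule: dec_induct) (auto intro: le_trans step inP)
  have "s i \<preceq> s j \<and> s i \<noteq> s j" if "i < j" for i j
  proof -
    have "s i \<preceq> s j" "s (Suc i) \<preceq> s j" using mono that by simp_all
    then show ?thesis using step[of i] le_antisym[OF _ _ inP inP] by metis
  qed
  then show ?thesis
    by (simp add: strictly_increasing_def monotone_def po_less_iff)
qed

text \<open>
  Ramsey's theorem, with pairs of indices coloured by how the two terms compare. Constant and
  decreasing subsequences share a colour, because only the bound by the first term matters.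
\<close>

lemma subseq_bounded_or_increasing_or_incomparable:
  fixes s :: "nat \<Rightarrow> 'p"
  obtains r :: "nat \<Rightarrow> nat" where "strict_mono r"
    "(\<forall>i. s (r i) \<preceq> s (r 0)) \<or> strictly_increasing lt (\<lambda>i. s (r i)) \<or>
     pairwise_incomparable lt (\<lambda>i. s (r i))"
proof -
  define colour :: "nat set \<Rightarrow> nat" where
    "colour = (\<lambda>Z. if s (Max Z) \<preceq> s (Min Z) then 0 else if s (Min Z) \<preceq> s (Max Z) then 1 else 2)"
  have "\<exists>Y t. Y \<subseteq> UNIV \<and> infinite Y \<and> t < 3 \<and> (\<forall>x\<in>Y. \<forall>y\<in>Y. x \<noteq> y \<longrightarrow> colour {x, y} = t)"
    by (rule Ramsey2) (auto simp: colour_def infinite_UNIV_nat)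
  then obtain Y t where Y: "infinite Y" "t < 3"
    and t: "\<And>x y. x \<in> Y \<Longrightarrow> y \<in> Y \<Longrightarrow> x \<noteq> y \<Longrightarrow> colour {x, y} = t"
    by metis
  obtain r :: "nat \<Rightarrow> nat" where r: "strict_mono r" "\<And>n. r n \<in> Y"
    using infinite_enumerate[OF Y(1)] by blast
  have col: "t = 0 \<longrightarrow> s (r j) \<preceq> s (r i)" "t = 1 \<longrightarrow> s (r i) \<preceq> s (r j) \<and> s (r i) \<noteq> s (r j)"
      "t = 2 \<longrightarrow> \<not> s (r i) \<preceq> s (r j) \<and> \<not> s (r j) \<preceq> s (r i)"
    if "i < j" for i j
  proof -
    have "r i < r j" using r(1) that by (simp add: strict_mono_less)
    then have m: "Max {r i, r j} = r j" "Min {r i, r j} = r i" "r i \<noteq> r j" by simp_all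
    show "t = 0 \<longrightarrow> s (r j) \<preceq> s (r i)" "t = 1 \<longrightarrow> s (r i) \<preceq> s (r j) \<and> s (r i) \<noteq> s (r j)"
      "t = 2 \<longrightarrow> \<not> s (r i) \<preceq> s (r j) \<and> \<not> s (r j) \<preceq> s (r i)"
      using t[OF r(2) r(2) m(3)] unfolding colour_def m(1,2) by (auto split: if_splits)
  qed
  consider "t = 0" | "t = 1" | "t = 2" using Y(2) by linarith
  then have "(\<forall>i. s (r i) \<preceq> s (r 0)) \<or> strictly_increasing lt (\<lambda>i. s (r i)) \<or>
     pairwise_incomparable lt (\<lambda>i. s (r i))"
  proof cases
    case 1
    then have "s (r i) \<preceq> s (r 0)" for i
      using col(1)[of 0 i] by (cases "i = 0") simp_all
    then show ?thesis by blast
  next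
    case 2
    then have "s (r i) \<preceq> s (r j) \<and> s (r i) \<noteq> s (r j)" if "i < j" for i j
      using col(2)[OF that] by blast
    then show ?thesis
      by (simp add: strictly_increasing_def monotone_def po_less_iff)
  next
    case 3
    then have "\<not> s (r i) \<preceq> s (r j)" if "i \<noteq> j" for i j
      using col(3)[of i j] col(3)[of j i] that by (meson nat_neq_iff)
    then show ?thesis by (simp add: incomparable_iff)
  qed
  with r(1) show thesis by (rule that)
qed

text \<open>
  A countable directed set without a greatest element has a strictly increasing cofinal sequence:
  step \<^term>\<open>n\<close> passes above the \<^term>\<open>n\<close>-th element of an enumeration.
\<close>

lemma increasing_sequence_of_countable_directed:
  assumes D: "D \<subseteq> P" "D \<noteq> {}" "countable D" and dir: "\<forall>x\<in>D. \<forall>y\<in>D. \<exists>z\<in>D. x \<preceq> z \<and> y \<preceq> z"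
    and sup: "is_po_sup P lt D s" and "s \<notin> D"
  obtains k where "range k \<subseteq> D" "strictly_increasing lt k" "is_po_sup P lt (range k) s"
proof -
  define e where "e = from_nat_into D"
  have e: "range e = D"
    using D by (simp add: e_def range_from_nat_into)
  have step: "\<exists>y. y \<in> D \<and> x \<preceq> y \<and> x \<noteq> y \<and> e n \<preceq> y" if x: "x \<in> D" for x n
  proof -
    obtain z where z: "z \<in> D" "x \<preceq> z" "e n \<preceq> z" using dir x e by blast
    have "\<not> s \<preceq> z"
      using z sup le_antisym D(1) \<open>s \<notin> D\<close> unfolding sup_iff by blast
    then obtain d where d: "d \<in> D" "\<not> d \<preceq> z"
      using sup z D(1) unfolding sup_iff by blast
    obtain y where y: "y \<in> D" "z \<preceq> y" "d \<preceq> y" using dir z d by blast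
    have P: "x \<in> P" "y \<in> P" "z \<in> P" "d \<in> P" "e n \<in> P" using x y z d e D(1) by blast+
    have "x \<noteq> y"
      using d(2) le_trans[OF y(3) _ P(4,2,3)] z(2) by blast
    then show ?thesis
      using y(1) le_trans[OF z(2) y(2) P(1,3,2)] le_trans[OF z(3) y(2) P(5,3,2)] by blast
  qed
  have "\<exists>k. \<forall>n. k n \<in> D \<and> (k n \<preceq> k (Suc n) \<and> k n \<noteq> k (Suc n) \<and> e n \<preceq> k (Suc n))"
    using D(2) step by (intro dependent_nat_choice[where P = "\<lambda>_ x. x \<in> D"]) blast+
  then obtain k where k: "\<And>n. k n \<in> D" "\<And>n. k n \<preceq> k (Suc n)" "\<And>n. k n \<noteq> k (Suc n)"
    "\<And>n. e n \<preceq> k (Suc n)" by blast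
  have kP: "k n \<in> P" for n using k(1) D(1) by blast
  have "s \<preceq> u" if u: "u \<in> P" "\<forall>x\<in>range k. x \<preceq> u" for u
  proof -
    have "e n \<preceq> u" for n
      using le_trans[OF k(4)[of n] _ _ kP u(1)] u(2) e D(1) by blast
    then show ?thesis using sup u(1) e unfolding sup_iff by blast
  qed
  then have "is_po_sup P lt (range k) s"
    using sup k(1) unfolding sup_iff by blast
  then show thesis
    using that[of k] k strictly_increasingI[of k] kP by blast
qed

text \<open>
  The ideal generated by an increasing sequence with supremum \<^term>\<open>p\<close> would contain \<^term>\<open>p\<close>
  by compactness, and then the sequence would stop increasing.
\<close>

lemma compact_imp_separated:
  assumes p: "p \<in> P" "po_compact P lt p"
  shows "separated_in P lt p"
  unfolding separated_in_def
proof
  assume "\<exists>s. range s \<subseteq> P \<and> strictly_increasing lt s \<and> is_po_sup P lt (range s) p"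
  then obtain s where s: "range s \<subseteq> P" "strictly_increasing lt s" "is_po_sup P lt (range s) p"
    by blast
  have sP: "s n \<in> P" for n using s(1) by blast
  define J where "J = {x \<in> P. \<exists>n. x \<preceq> s n}"
  have "po_ideal P lt J"
    unfolding ideal_iff
  proof (intro conjI ballI impI)
    show "J \<noteq> {}" using sP by (auto simp: J_def intro!: exI[of _ "s 0"] exI[of _ "0::nat"])
    fix x assume x: "x \<in> J"
    then obtain n where n: "x \<preceq> s n" "x \<in> P" by (auto simp: J_def)
    show "y \<in> J" if "y \<in> P" "y \<preceq> x" for y
      using that n le_trans[OF that(2) n(1) that(1) n(2) sP] by (auto simp: J_def)
    fix y assume "y \<in> J"
    then obtain m where m: "y \<preceq> s m" "y \<in> P" by (auto simp: J_def)
    have "s n \<preceq> s (max n m)" "s m \<preceq> s (max n m)"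
      using strictly_increasing_le[OF s(2)] by simp_all
    then show "\<exists>z\<in>J. x \<preceq> z \<and> y \<preceq> z"
      using le_trans[OF n(1) _ n(2) sP sP] le_trans[OF m(1) _ m(2) sP sP] sP le_refl
      unfolding J_def by blast
  qed (auto simp: J_def)
  moreover have "is_po_sup P lt J p"
    unfolding sup_iff
  proof (intro conjI ballI impI)
    show "x \<preceq> p" if "x \<in> J" for x
      using that s(3) le_trans[OF _ _ _ sP p(1)] unfolding J_def sup_iff by blast
    show "p \<preceq> u" if "u \<in> P" "\<forall>x\<in>J. x \<preceq> u" for u
      using that s(3) sP le_refl unfolding J_def sup_iff by blast
  qed (rule p(1))
  ultimately have "p \<in> J"
    using p(2) by (auto simp: po_compact_def)
  then obtain n where n: "p \<preceq> s n" by (auto simp: J_def)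
  have "s (Suc n) \<preceq> p" using s(3) by (auto simp: sup_iff)
  then have "s (Suc n) \<preceq> s n" using n le_trans[OF _ _ sP p(1) sP] by blast
  then show False
    using strictly_increasing_less[OF s(2), of n "Suc n"] le_antisym[OF _ _ sP sP] by blast
qed

end

section \<open>Bases and sequences in omega-Stone spaces\<close>

locale stone =
  fixes W :: "'w topology"
  assumes stone: "omega_Stone_space W"
begin

lemma compact_open_imp_closed: "compactin W A \<Longrightarrow> closedin W A"
  using stone compactin_imp_closedin unfolding omega_Stone_space_def by blast

lemma compact_open_neighbourhood:
  assumes "openin W U" "w \<in> U"
  obtains A where "compactin W A" "openin W A" "w \<in> A" "A \<subseteq> U"
  using assms stone unfolding omega_Stone_space_def openin_topology_base_unique by meson

lemma decreasing_base:
  assumes w: "w \<in> topspace W"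
  obtains B :: "nat \<Rightarrow> 'w set" where "\<And>n. compactin W (B n)" "\<And>n. openin W (B n)" "\<And>n. w \<in> B n"
    "decseq B" "\<And>U. openin W U \<Longrightarrow> w \<in> U \<Longrightarrow> \<exists>n. B n \<subseteq> U"
proof -
  define C where "C = {A. compactin W A \<and> openin W A \<and> w \<in> A}"
  have "countable C"
    by (rule countable_subset[of _ "{A. compactin W A \<and> openin W A}"])
       (use stone in \<open>auto simp: C_def omega_Stone_space_def\<close>)
  moreover have "C \<noteq> {}"
    using compact_open_neighbourhood[OF openin_topspace w] by (auto simp: C_def)
  ultimately have rng: "range (from_nat_into C) = C"
    by (simp add: range_from_nat_into)
  then have mem: "compactin W (from_nat_into C n) \<and> openin W (from_nat_into C n) \<and>
    w \<in> from_nat_into C n" for n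
    by (auto simp: C_def set_eq_iff)
  define B where "B = (\<lambda>n. \<Inter>i\<le>n. from_nat_into C i)"
  have "closedin W (B n)" for n
    unfolding B_def using mem by (intro closedin_INT compact_open_imp_closed) auto
  then have "compactin W (B n)" for n
    using closed_compactin[of W "from_nat_into C 0" "B n"] mem by (auto simp: B_def)
  moreover have "openin W (B n)" for n
    unfolding B_def using mem by (intro openin_INT2) auto
  moreover have "w \<in> B n" for n using mem by (auto simp: B_def)
  moreover have "decseq B" by (force simp: B_def decseq_def)
  moreover have "\<exists>n. B n \<subseteq> U" if U: "openin W U" "w \<in> U" for U
  proof -
    obtain A where "A \<in> C" "A \<subseteq> U"
      using compact_open_neighbourhood[OF U] by (auto simp: C_def)
    then obtain n where "from_nat_into C n \<subseteq> U" using rng by (metis rangeE)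
    then show ?thesis by (auto simp: B_def)
  qed
  ultimately show thesis by (rule that)
qed

lemma limit_along_base:
  assumes "decseq B" "\<And>U. openin W U \<Longrightarrow> w \<in> U \<Longrightarrow> \<exists>n. B n \<subseteq> U" "\<And>n. x n \<in> B n"
    and "w \<in> topspace W"
  shows "limitin W x w sequentially"
  unfolding limitin_sequentially
proof (intro conjI allI impI)
  fix U assume "openin W U \<and> w \<in> U"
  then obtain n where "B n \<subseteq> U" using assms(2) by blast
  then have "\<forall>m\<ge>n. x m \<in> U"
    using assms(3) decseqD[OF assms(1)] by blast
  then show "\<exists>N. \<forall>n\<ge>N. x n \<in> U" by blast
qed (use assms in auto)

lemma limit_of_meeting_neighbourhoods:
  assumes w: "w \<in> topspace W" and meets: "\<And>U. openin W U \<Longrightarrow> w \<in> U \<Longrightarrow> \<exists>v\<in>U. Q v"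
  obtains x where "\<And>n. Q (x n)" "range x \<subseteq> topspace W" "limitin W x w sequentially"
proof -
  obtain B where B: "\<And>n. compactin W (B n)" "\<And>n. openin W (B n)" "\<And>n. w \<in> B n"
    "decseq B" "\<And>U. openin W U \<Longrightarrow> w \<in> U \<Longrightarrow> \<exists>n. B n \<subseteq> U"
    using decreasing_base[OF w] by blast
  have "\<forall>n. \<exists>v. v \<in> B n \<and> Q v" using meets[OF B(2,3)] by blast
  then obtain x where x: "\<And>n. x n \<in> B n" "\<And>n. Q (x n)" by metis
  show thesis
  proof (rule that)
    show "range x \<subseteq> topspace W" using x(1) openin_subset[OF B(2)] by blast
    show "limitin W x w sequentially" by (rule limit_along_base[OF B(4,5) x(1) w])
  qed (rule x(2))
qed

text \<open>
  Compact sets are sequentially compact: a point in all closures of tails is a cluster point, and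
  its countable base selects a convergent subsequence.
\<close>

lemma convergent_subsequence:
  assumes K: "compactin W K" and x: "\<And>n. x n \<in> K"
  obtains r :: "nat \<Rightarrow> nat" and w where "strict_mono r" "limitin W (\<lambda>n. x (r n)) w sequentially"
proof -
  define T where "T = (\<lambda>n. W closure_of (x ` {n..}))"
  have KW: "K \<subseteq> topspace W" using K compactin_subset_topspace by blast
  have "K \<inter> \<Inter> (range T) \<noteq> {}"
  proof (rule compactin_fip[THEN iffD1, OF K, THEN conjunct2, rule_format], intro conjI ballI allI impI)
    fix C assume "C \<in> range T" then show "closedin W C" by (auto simp: T_def)
  next
    fix F assume F: "finite F \<and> F \<subseteq> range T"
    then obtain N where N: "finite N" "F = T ` N" by (meson finite_subset_image)
    have "x (Max (insert 0 N)) \<in> T n" if "n \<in> N" for n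
    proof -
      have "x (Max (insert 0 N)) \<in> x ` {n..}" using that N(1) by auto
      then show ?thesis 
        unfolding T_def using closure_of_subset[of "x ` {n..}" W] x KW by blast
    qed
    then show "K \<inter> \<Inter> F \<noteq> {}" using x N(2) by blast
  qed
  then obtain w where w: "w \<in> K" "\<And>n. w \<in> T n" by auto
  then have wW: "w \<in> topspace W" using KW by blast
  have cluster: "\<exists>i\<ge>n. x i \<in> U" if "openin W U" "w \<in> U" for U n
    using w(2)[of n] that unfolding T_def in_closure_of by fastforce
  obtain B where B: "\<And>n. compactin W (B n)" "\<And>n. openin W (B n)" "\<And>n. w \<in> B n"
    "decseq B" "\<And>U. openin W U \<Longrightarrow> w \<in> U \<Longrightarrow> \<exists>n. B n \<subseteq> U"
    using decreasing_base[OF wW] by blast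
  have "\<exists>r. \<forall>n. x (r n) \<in> B n \<and> r n < r (Suc n)"
  proof (rule dependent_nat_choice)
    show "\<exists>i. x i \<in> B 0" using cluster[OF B(2,3)] by blast
    show "\<exists>j. x j \<in> B (Suc n) \<and> i < j" for i n
      using cluster[OF B(2,3), of "Suc i" "Suc n"] by (auto simp: Suc_le_eq)
  qed
  then obtain r where r: "\<And>n. x (r n) \<in> B n" "\<And>n. r n < r (Suc n)" by blast
  then show thesis
    using that[of r w] limit_along_base[OF B(4,5) _ wW, of "\<lambda>n. x (r n)"]
    by (simp add: strict_mono_Suc_iff)
qed

end

section \<open>Labels of points in a complete partition\<close>

locale po_partition = po P lt + stone W
  for W :: "'w topology" and P :: "'p set" and lt :: "'p \<Rightarrow> 'p \<Rightarrow> bool" +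
  fixes X :: "'p \<Rightarrow> 'w set"
  assumes complete: "complete_partition W P lt X"
begin

abbreviation tau :: "'w \<Rightarrow> 'p" ("\<tau>") where "\<tau> \<equiv> label P X"

lemma label_in: "w \<in> topspace W \<Longrightarrow> \<tau> w \<in> P"
  and in_X_label: "w \<in> topspace W \<Longrightarrow> w \<in> X (\<tau> w)"
  using complete label_eq[OF complete] unfolding complete_partition_def by force+

lemma in_X_iff: "p \<in> P \<Longrightarrow> w \<in> X p \<longleftrightarrow> w \<in> topspace W \<and> \<tau> w = p"
  using complete label_eq[OF complete] in_X_label unfolding complete_partition_def by blast

lemma point_with_label:
  assumes "p \<in> P" shows "\<exists>w\<in>topspace W. \<tau> w = p"
  using assms complete in_X_iff unfolding complete_partition_def by blast

lemma in_derived_X_iff: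
  "p \<in> P \<Longrightarrow> w \<in> W derived_set_of X p \<longleftrightarrow> w \<in> topspace W \<and> lt (\<tau> w) p"
  using complete in_X_iff label_in unfolding complete_partition_def by (auto 4 3)

lemma closure_X: "p \<in> P \<Longrightarrow> W closure_of X p = {w \<in> topspace W. \<tau> w \<preceq> p}"
  by (auto simp: closure_of in_derived_X_iff in_X_iff le_iff)

lemma closedin_labels_below: "p \<in> P \<Longrightarrow> closedin W {w \<in> topspace W. \<tau> w \<preceq> p}"
  using closure_X closedin_closure_of by metis

lemma open_meets_larger:
  assumes "openin W U" "w \<in> U" "\<tau> w \<preceq> p" "p \<in> P"
  obtains v where "v \<in> U" "\<tau> v = p"
proof -
  have "w \<in> W closure_of X p"
    using assms closure_X openin_subset by fastforce
  then show thesis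
    using that assms in_X_iff unfolding in_closure_of by blast
qed

lemma label_le_of_meeting:
  assumes w: "w \<in> topspace W" and u: "u \<in> P"
    and meets: "\<And>U. openin W U \<Longrightarrow> w \<in> U \<Longrightarrow> \<exists>v\<in>U. \<tau> v \<preceq> u"
  shows "\<tau> w \<preceq> u"
proof (rule ccontr)
  let ?U = "topspace W - {w \<in> topspace W. \<tau> w \<preceq> u}"
  assume "\<not> \<tau> w \<preceq> u"
  then have "w \<in> ?U" using w by blast
  moreover have "openin W ?U" using closedin_labels_below[OF u] by blast
  ultimately show False using meets by blast
qed

lemma limit_label_le:
  assumes lim: "limitin W x w sequentially" and x: "range x \<subseteq> topspace W"
    and "\<And>n. \<tau> (x n) \<preceq> u" and u: "u \<in> P"
  shows "\<tau> w \<preceq> u"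
proof -
  have "w \<in> {w \<in> topspace W. \<tau> w \<preceq> u}"
    by (rule limitin_closedin[OF lim closedin_labels_below[OF u]]) (use assms in \<open>auto simp: subset_iff intro!: always_eventually\<close>)
  then show ?thesis by blast
qed

section \<open>Trim sets\<close>

text \<open>
  The labels met by an open set form an upper set, so a trim set is described by a least label
  that is attained.
\<close>

lemma p_trim_iff:
  assumes p: "p \<in> P"
  shows "p_trim W P lt X p A \<longleftrightarrow> compactin W A \<and> openin W A \<and> (\<forall>w\<in>A. p \<preceq> \<tau> w) \<and> (\<exists>v\<in>A. \<tau> v = p) \<and>
    (p \<in> discrete_part P lt \<longrightarrow> card (A \<inter> X p) = 1)"
proof -
  have "{q \<in> P. A \<inter> X q \<noteq> {}} = upset P lt p \<longleftrightarrow> (\<forall>w\<in>A. p \<preceq> \<tau> w) \<and> (\<exists>v\<in>A. \<tau> v = p)"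
    if A: "openin W A"
  proof -
    have AW: "A \<subseteq> topspace W" using A openin_subset by blast
    have labels: "{q \<in> P. A \<inter> X q \<noteq> {}} = \<tau> ` A"
      using AW in_X_iff label_in by fastforce
    have "upset P lt p \<subseteq> \<tau> ` A" if "\<exists>v\<in>A. \<tau> v = p"
      using open_meets_larger[OF A] that by (metis imageI subsetI upset_iff)
    moreover have "p \<in> \<tau> ` A" if "upset P lt p \<subseteq> \<tau> ` A" using that p upset_iff by auto
    moreover have "\<tau> ` A \<subseteq> upset P lt p \<longleftrightarrow> (\<forall>w\<in>A. p \<preceq> \<tau> w)"
      using AW label_in upset_iff by blast
    ultimately have "\<tau> ` A = upset P lt p \<longleftrightarrow> (\<forall>w\<in>A. p \<preceq> \<tau> w) \<and> (\<exists>v\<in>A. \<tau> v = p)"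
      by blast
    then show ?thesis unfolding labels .
  qed
  then show ?thesis by (auto simp: p_trim_def)
qed

lemma p_trim_open: "p_trim W P lt X p A \<Longrightarrow> openin W A"
  by (simp add: p_trim_def)

lemma trim_label_unique:
  assumes "p_trim W P lt X p A" "p_trim W P lt X q A" "p \<in> P" "q \<in> P"
  shows "p = q"
proof -
  have "p \<preceq> q" "q \<preceq> p" using assms p_trim_iff by auto
  then show ?thesis using le_antisym assms by blast
qed

lemma countable_trim_labels: "countable (trim_labels W P lt X)"
proof -
  have "\<forall>p\<in>trim_labels W P lt X. \<exists>A. p_trim W P lt X p A" by (auto simp: trim_labels_def)
  then obtain A where A: "\<And>p. p \<in> trim_labels W P lt X \<Longrightarrow> p_trim W P lt X p (A p)" by metis
  have "inj_on A (trim_labels W P lt X)"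
    using A trim_label_unique unfolding inj_on_def trim_labels_def by (metis (lifting) mem_Collect_eq)
  moreover have "A ` trim_labels W P lt X \<subseteq> {A. compactin W A \<and> openin W A}"
    using A by (auto simp: p_trim_def)
  then have "countable (A ` trim_labels W P lt X)"
    using stone countable_subset unfolding omega_Stone_space_def by blast
  ultimately show ?thesis using countable_image_inj_on by blast
qed

text \<open>
  A point labelled above \<^term>\<open>q\<close> is never a limit of other points of \<^term>\<open>X q\<close> when \<^term>\<open>q\<close>
  is irreflexive, since such limits have labels strictly below \<^term>\<open>q\<close>.
\<close>

lemma isolating_neighbourhood:
  assumes q: "q \<in> P" and U: "openin W U" "w \<in> U" and le: "q \<preceq> \<tau> w"
  obtains V where "compactin W V" "openin W V" "w \<in> V" "V \<subseteq> U"
    "q \<in> discrete_part P lt \<Longrightarrow> V \<inter> X q \<subseteq> {w}"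
proof (cases "q \<in> discrete_part P lt")
  case True
  have wW: "w \<in> topspace W" using U openin_subset by blast
  have "\<not> lt (\<tau> w) q"
    using True le le_antisym[of q "\<tau> w"] label_in[OF wW] q
    by (auto simp: discrete_part_def le_iff)
  then obtain T where T: "openin W T" "w \<in> T" "\<forall>y\<in>T. y \<in> X q \<longrightarrow> y = w"
    using in_derived_X_iff[OF q, of w] wW by (auto simp: in_derived_set_of)
  obtain V where "compactin W V" "openin W V" "w \<in> V" "V \<subseteq> U \<inter> T"
    using compact_open_neighbourhood[of "U \<inter> T" w] U T by blast
  then show thesis using that T(3) by blast
next
  case False
  then show thesis using that compact_open_neighbourhood[OF U] by metis
qed

text \<open>
  Trim neighbourhoods are glued from two pieces: a small neighbourhood of the given point, and a
  small neighbourhood of a point that attains the least label.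
\<close>

lemma trim_neighbourhood_by_gluing:
  assumes q: "q \<in> P" and above: "openin W {w \<in> topspace W. q \<preceq> \<tau> w}"
    and U: "openin W U" "w \<in> U" and le: "q \<preceq> \<tau> w" and v: "v \<in> U" "\<tau> v = q"
  obtains A where "p_trim W P lt X q A" "w \<in> A" "A \<subseteq> U"
proof -
  let ?U = "U \<inter> {w \<in> topspace W. q \<preceq> \<tau> w}"
  have UW: "U \<subseteq> topspace W" using U openin_subset by blast
  have U': "openin W ?U" "w \<in> ?U" "v \<in> ?U" using U above UW le v by auto
  obtain V1 where V1: "compactin W V1" "openin W V1" "w \<in> V1" "V1 \<subseteq> ?U"
    "q \<in> discrete_part P lt \<Longrightarrow> V1 \<inter> X q \<subseteq> {w}"
    using isolating_neighbourhood[OF q U'(1,2) le] by metis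
  obtain V2 where V2: "compactin W V2" "openin W V2" "v \<in> V2" "V2 \<subseteq> ?U"
    "q \<in> discrete_part P lt \<Longrightarrow> V2 \<inter> X q \<subseteq> {v}"
    using isolating_neighbourhood[OF q U'(1,3)] v(2) le_refl by metis
  show thesis
  proof (cases "\<tau> w = q")
    case True
    have "w \<in> X q" using in_X_iff[OF q] True U(2) UW by blast
    then have "q \<in> discrete_part P lt \<longrightarrow> V1 \<inter> X q = {w}" using V1 by blast
    then have "p_trim W P lt X q V1"
      using V1 True by (auto simp: p_trim_iff[OF q])
    then show thesis using that V1 by blast
  next
    case False
    have "w \<notin> X q" "v \<in> X q" using in_X_iff[OF q] False v UW by blast+
    then have "q \<in> discrete_part P lt \<longrightarrow> (V1 \<union> V2) \<inter> X q = {v}" using V1(5) V2(3,5) by blast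
    then have "p_trim W P lt X q (V1 \<union> V2)"
      using V1(1,2,4) V2(1-4) v(2)
      by (auto simp: p_trim_iff[OF q] compactin_Un openin_Un)
    then show thesis using that[of "V1 \<union> V2"] V1 V2 by blast
  qed
qed

text \<open>
  The condition that trim sets form a neighbourhood base everywhere, with the least label made
  explicit. As trim sets are open, they can serve as the neighbourhoods themselves.
\<close>

definition trim_base :: bool where
  "trim_base \<longleftrightarrow> (\<forall>U w. openin W U \<and> w \<in> U \<longrightarrow> (\<exists>m\<in>P. \<exists>A. p_trim W P lt X m A \<and> w \<in> A \<and> A \<subseteq> U))"

lemma trim_base_iff: "trim_base \<longleftrightarrow> (\<forall>w\<in>topspace W. neighbourhood_base_at w (trim W P lt X) W)"
proof
  assume L: trim_base
  show "\<forall>w\<in>topspace W. neighbourhood_base_at w (trim W P lt X) W"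
    unfolding neighbourhood_base_at_def trim_def
    using L p_trim_open unfolding trim_base_def by (meson order_refl)
next
  assume R: "\<forall>w\<in>topspace W. neighbourhood_base_at w (trim W P lt X) W"
  show trim_base
    unfolding trim_base_def
  proof (intro allI impI)
    fix U w assume U: "openin W U \<and> w \<in> U"
    then have "neighbourhood_base_at w (trim W P lt X) W" using R openin_subset by blast
    then show "\<exists>m\<in>P. \<exists>A. p_trim W P lt X m A \<and> w \<in> A \<and> A \<subseteq> U"
      using U unfolding neighbourhood_base_at_def trim_def by (meson subsetD)
  qed
qed

definition trim_labels_at :: "'w \<Rightarrow> 'p set" where
  "trim_labels_at w = {m \<in> P. \<exists>A. p_trim W P lt X m A \<and> w \<in> A}"

lemma trim_labels_at_subset: "trim_labels_at w \<subseteq> trim_labels W P lt X"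
  by (auto simp: trim_labels_at_def trim_labels_def)

lemma trim_labels_subset: "trim_labels W P lt X \<subseteq> P"
  by (auto simp: trim_labels_def)

text \<open>
  Trim neighbourhoods that shrink to \<^term>\<open>w\<close> contain points of their least labels, and these
  points tend to \<^term>\<open>w\<close>. Hence no label short of \<^term>\<open>\<tau> w\<close> bounds these least labels.
\<close>

lemma sup_trim_labels_at:
  assumes base: trim_base and w: "w \<in> topspace W"
  shows "is_po_sup P lt (trim_labels_at w) (\<tau> w)"
  unfolding sup_iff
proof (intro conjI ballI impI)
  show "m \<preceq> \<tau> w" if "m \<in> trim_labels_at w" for m
    using that by (auto simp: trim_labels_at_def p_trim_iff)
  fix u assume u: "u \<in> P" "\<forall>m\<in>trim_labels_at w. m \<preceq> u"
  show "\<tau> w \<preceq> u"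
  proof (rule label_le_of_meeting[OF w u(1)])
    fix U assume "openin W U" "w \<in> U"
    then obtain m A where A: "m \<in> P" "p_trim W P lt X m A" "w \<in> A" "A \<subseteq> U"
      using base unfolding trim_base_def by blast
    then have "m \<preceq> u" using u by (auto simp: trim_labels_at_def)
    then show "\<exists>v\<in>U. \<tau> v \<preceq> u" using A p_trim_iff[OF A(1)] by blast
  qed
qed (rule label_in[OF w])

lemma trim_labels_at_nonempty:
  assumes trim_base "w \<in> topspace W"
  shows "trim_labels_at w \<noteq> {}"
  using assms openin_topspace unfolding trim_base_def trim_labels_at_def by blast

lemma trim_labels_at_directed:
  assumes base: trim_base and "a \<in> trim_labels_at w" "b \<in> trim_labels_at w"
  shows "\<exists>c\<in>trim_labels_at w. a \<preceq> c \<and> b \<preceq> c"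
proof -
  obtain A B where A: "a \<in> P" "p_trim W P lt X a A" "w \<in> A" and B: "b \<in> P" "p_trim W P lt X b B" "w \<in> B"
    using assms by (auto simp: trim_labels_at_def)
  have "openin W (A \<inter> B)" "w \<in> A \<inter> B" using A B p_trim_open by auto
  then obtain c C where C: "c \<in> P" "p_trim W P lt X c C" "w \<in> C" "C \<subseteq> A \<inter> B"
    using base unfolding trim_base_def by meson
  obtain v where "v \<in> C" "\<tau> v = c" using C p_trim_iff[OF C(1)] by blast
  then have "a \<preceq> c" "b \<preceq> c" using A B C p_trim_iff by blast+
  then show ?thesis using C by (auto simp: trim_labels_at_def)
qed

text \<open>
  The countable directed set of trim labels at a point of a separated label contains its supremum,
  for otherwise a strictly increasing sequence in it would have the same supremum.
\<close>

lemma separated_label_trim: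
  assumes base: trim_base and w: "w \<in> topspace W" and sep: "separated_in P lt (\<tau> w)"
  shows "\<tau> w \<in> trim_labels_at w"
proof (rule ccontr)
  assume "\<tau> w \<notin> trim_labels_at w"
  moreover have sub: "trim_labels_at w \<subseteq> P" by (auto simp: trim_labels_at_def)
  moreover have "countable (trim_labels_at w)"
    using countable_trim_labels trim_labels_at_subset countable_subset by blast
  ultimately obtain k where "range k \<subseteq> trim_labels_at w" "strictly_increasing lt k"
    "is_po_sup P lt (range k) (\<tau> w)"
    using increasing_sequence_of_countable_directed[of "trim_labels_at w" "\<tau> w"]
      trim_labels_at_nonempty[OF base w] trim_labels_at_directed[OF base]
      sup_trim_labels_at[OF base w] by blast
  then show False using sep sub unfolding separated_in_def by blast
qed

section \<open>Rank partitions are strongly semi-trim\<close>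

lemma rank_partition_iff:
  "rank_partition W P lt X \<longleftrightarrow>
     (\<forall>q\<in>P. \<forall>x y. separated_in P lt q \<and> range x \<subseteq> topspace W \<and> limitin W x y sequentially \<and>
        q \<preceq> \<tau> y \<and> (pairwise_incomparable lt (\<lambda>k. \<tau> (x k)) \<or> strictly_increasing lt (\<lambda>k. \<tau> (x k)))
        \<longrightarrow> (\<forall>\<^sub>F k in sequentially. q \<preceq> \<tau> (x k))) \<and>
     (\<forall>y\<in>topspace W. \<not> separated_in P lt (\<tau> y) \<longrightarrow>
        (\<exists>x. range x \<subseteq> topspace W \<and> limitin W x y sequentially \<and> (\<forall>k. po_less lt (\<tau> (x k)) (\<tau> y))))"
  by (simp add: rank_partition_def le_def)

text \<open>
  A sequence tending to a point labelled above \<^term>\<open>q\<close> whose labels avoid the upper set of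
  \<^term>\<open>q\<close> has a subsequence of one of Ramsey's types. Bounded labels would pass their bound to
  the limit, and the other types are excluded by the first rank condition.
\<close>

lemma openin_labels_above_separated:
  assumes R: "rank_partition W P lt X" and q: "q \<in> P" "separated_in P lt q"
  shows "openin W {w \<in> topspace W. q \<preceq> \<tau> w}"
proof (rule ccontr)
  assume "\<not> openin W {w \<in> topspace W. q \<preceq> \<tau> w}"
  then obtain w where w: "w \<in> topspace W" "q \<preceq> \<tau> w"
    and no: "\<And>U. openin W U \<Longrightarrow> w \<in> U \<Longrightarrow> \<not> U \<subseteq> {w \<in> topspace W. q \<preceq> \<tau> w}"
    by (subst (asm) openin_subopen) blast
  have "\<exists>v\<in>U. \<not> q \<preceq> \<tau> v" if "openin W U" "w \<in> U" for U
    using no[OF that] openin_subset[OF that(1)] by blast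
  then obtain x where x: "\<And>n. \<not> q \<preceq> \<tau> (x n)" "range x \<subseteq> topspace W" "limitin W x w sequentially"
    using limit_of_meeting_neighbourhoods[OF w(1), of "\<lambda>v. \<not> q \<preceq> \<tau> v"] by blast
  obtain r :: "nat \<Rightarrow> nat" where r: "strict_mono r" and cases: "(\<forall>i. \<tau> (x (r i)) \<preceq> \<tau> (x (r 0))) \<or>
      strictly_increasing lt (\<lambda>i. \<tau> (x (r i))) \<or> pairwise_incomparable lt (\<lambda>i. \<tau> (x (r i)))"
    by (rule subseq_bounded_or_increasing_or_incomparable[of "\<lambda>n. \<tau> (x n)"])
  have lim: "limitin W (\<lambda>i. x (r i)) w sequentially"
    using limitin_subsequence[OF r x(3)] by (simp add: o_def)
  have rng: "range (\<lambda>i. x (r i)) \<subseteq> topspace W" using x(2) by blast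
  show False
  proof (cases "\<forall>i. \<tau> (x (r i)) \<preceq> \<tau> (x (r 0))")
    case True
    have P: "\<tau> (x (r 0)) \<in> P" using label_in x(2) by blast
    have "\<tau> w \<preceq> \<tau> (x (r 0))" using limit_label_le[OF lim rng _ P] True by blast
    then have "q \<preceq> \<tau> (x (r 0))" using le_trans[OF w(2) _ q(1) label_in[OF w(1)] P] by blast
    then show False using x(1) by blast
  next
    case False
    then have "\<forall>\<^sub>F i in sequentially. q \<preceq> \<tau> (x (r i))"
      using R q lim rng w(2) cases unfolding rank_partition_iff by blast
    then show False using x(1) by simp
  qed
qed

text \<open>
  Zorn's lemma below \<^term>\<open>\<tau> w\<close>: a chain of labels of \<^term>\<open>K\<close> has a lower bound, because the
  closed sets of points labelled below its members have a common point in \<^term>\<open>K\<close>.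
\<close>

lemma minimal_label_in_compact:
  assumes K: "compactin W K" and w: "w \<in> K"
  obtains v where "v \<in> K" "\<tau> v \<preceq> \<tau> w" "\<And>u. u \<in> K \<Longrightarrow> \<tau> u \<preceq> \<tau> v \<Longrightarrow> \<tau> u = \<tau> v"
proof -
  have KW: "K \<subseteq> topspace W" using K compactin_subset_topspace by blast
  define L where "L = {p \<in> \<tau> ` K. p \<preceq> \<tau> w}"
  have LP: "L \<subseteq> P" using KW label_in by (auto simp: L_def)
  have wL: "\<tau> w \<in> L" using w by (auto simp: L_def)
  let ?R = "relation_of (\<lambda>a b. b \<preceq> a) L"
  have "\<exists>m\<in>L. \<forall>a\<in>L. a \<preceq> m \<longrightarrow> a = m"
  proof (rule predicate_Zorn)
    show "partial_order_on L ?R"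
      by (rule partial_order_on_relation_ofI)
         (use LP le_refl le_antisym le_trans in \<open>meson subsetD\<close>)+
    fix C assume C: "C \<in> Chains ?R"
    then have CL: "C \<subseteq> L" and chain: "\<And>a b. a \<in> C \<Longrightarrow> b \<in> C \<Longrightarrow> a \<preceq> b \<or> b \<preceq> a"
      unfolding Chains_def relation_of_def by blast+
    have least: "\<exists>m\<in>L. (m \<in> F \<or> F = {}) \<and> (\<forall>a\<in>F. m \<preceq> a)" if "finite F" "F \<subseteq> C" for F
      using that
    proof (induction F rule: finite_induct)
      case empty then show ?case using wL by blast
    next
      case (insert a F)
      then obtain m where m: "m \<in> L" "m \<in> F \<or> F = {}" "\<forall>b\<in>F. m \<preceq> b" by blast
      have aL: "a \<in> L" "a \<in> C" using insert CL by auto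
      show ?case
      proof (cases "F = {} \<or> a \<preceq> m")
        case True
        then have "\<forall>b\<in>insert a F. a \<preceq> b"
          using m(3) le_trans[of a m] aL m(1) LP insert.prems CL by (metis insertE le_refl empty_iff insert_subset subsetD)
        then show ?thesis using aL by blast
      next
        case False
        then have "m \<preceq> a" using chain[of a m] m(2) aL insert.prems by blast
        then show ?thesis using m False by blast
      qed
    qed
    \<comment> \<open>The closed set of \<^term>\<open>\<tau> w\<close> provides a lower bound in \<^term>\<open>L\<close> for the empty chain too.\<close>
    let ?B = "\<lambda>c. {u \<in> topspace W. \<tau> u \<preceq> c}"
    have "K \<inter> \<Inter> (insert (?B (\<tau> w)) (?B ` C)) \<noteq> {}"
    proof (rule compactin_fip[THEN iffD1, OF K, THEN conjunct2, rule_format], intro conjI ballI allI impI)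
      fix T assume "T \<in> insert (?B (\<tau> w)) (?B ` C)"
      then show "closedin W T" using closedin_labels_below CL LP wL by blast
    next
      fix G assume F: "finite G \<and> G \<subseteq> insert (?B (\<tau> w)) (?B ` C)"
      then have "finite (G - {?B (\<tau> w)})" "G - {?B (\<tau> w)} \<subseteq> ?B ` C" by auto
      then obtain F where F': "finite F" "F \<subseteq> C" "G - {?B (\<tau> w)} = ?B ` F"
        by (meson finite_subset_image)
      then obtain m where m: "m \<in> L" "\<forall>a\<in>F. m \<preceq> a" using least[OF F'(1,2)] by blast
      then obtain u where u: "u \<in> K" "\<tau> u = m" "m \<preceq> \<tau> w" by (auto simp: L_def)
      then have uB: "u \<in> ?B c" if "c \<in> F \<or> c = \<tau> w" for c using that m(2) KW by auto
      have "u \<in> T" if "T \<in> G" for T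
      proof (cases "T = ?B (\<tau> w)")
        case False
        then have "T \<in> ?B ` F" using that F'(3) by blast
        then show ?thesis using uB by blast
      qed (use uB in blast)
      then show "K \<inter> \<Inter> G \<noteq> {}" using u(1) by blast
    qed
    then obtain u where "u \<in> K" "\<tau> u \<preceq> \<tau> w" "\<forall>c\<in>C. \<tau> u \<preceq> c" by blast
    then show "\<exists>u\<in>L. \<forall>a\<in>C. u \<preceq> a" unfolding L_def by blast
  qed
  then obtain m where m: "m \<in> L" "\<And>a. a \<in> L \<Longrightarrow> a \<preceq> m \<Longrightarrow> a = m" by blast
  then obtain v where v: "v \<in> K" "\<tau> v = m" "m \<preceq> \<tau> w" by (auto simp: L_def)
  have "\<tau> u = \<tau> v" if u: "u \<in> K" "\<tau> u \<preceq> \<tau> v" for u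
  proof -
    have "\<tau> u \<preceq> \<tau> w" using le_trans[of "\<tau> u" m "\<tau> w"] u v KW label_in w by blast
    then show ?thesis using m(2) u v by (auto simp: L_def)
  qed
  then show thesis using that v by blast
qed

text \<open>
  If the label were not separated, the second rank condition would give nearby points of
  strictly smaller label.
\<close>

lemma separated_of_minimal_label:
  assumes R: "rank_partition W P lt X" and U: "openin W U" "v \<in> U"
    and min: "\<And>u. u \<in> U \<Longrightarrow> \<tau> u \<preceq> \<tau> v \<Longrightarrow> \<tau> u = \<tau> v"
  shows "separated_in P lt (\<tau> v)"
proof (rule ccontr)
  have vW: "v \<in> topspace W" using U openin_subset by blast
  assume "\<not> separated_in P lt (\<tau> v)"
  then obtain x where x: "limitin W x v sequentially" "\<And>k. po_less lt (\<tau> (x k)) (\<tau> v)"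
    using R vW unfolding rank_partition_iff by blast
  then obtain n where "x n \<in> U"
    using U unfolding limitin_sequentially by blast
  then show False using min x(2)[of n] by (auto simp: po_less_iff)
qed

lemma trim_label_separated:
  assumes R: "rank_partition W P lt X" and p: "p \<in> trim_labels W P lt X"
  shows "separated_in P lt p"
proof -
  obtain A where A: "p \<in> P" "p_trim W P lt X p A" using p by (auto simp: trim_labels_def)
  then obtain v where v: "v \<in> A" "\<tau> v = p" using p_trim_iff by blast
  have AW: "A \<subseteq> topspace W" using A(2) p_trim_open openin_subset by blast
  have "separated_in P lt (\<tau> v)"
  proof (rule separated_of_minimal_label[OF R p_trim_open[OF A(2)] v(1)])
    fix u assume "u \<in> A" "\<tau> u \<preceq> \<tau> v"
    then show "\<tau> u = \<tau> v" using v A p_trim_iff le_antisym label_in AW by blast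
  qed
  then show ?thesis using v by simp
qed

text \<open>
  A minimal label of a small compact open neighbourhood is separated, so the points above it form
  an open set and a trim neighbourhood with this least label can be glued.
\<close>

lemma rank_partition_trim_base:
  assumes R: "rank_partition W P lt X"
  shows trim_base
  unfolding trim_base_def
proof (intro allI impI)
  fix U w assume U: "openin W U \<and> w \<in> U"
  then obtain K where K: "compactin W K" "openin W K" "w \<in> K" "K \<subseteq> U"
    using compact_open_neighbourhood by metis
  obtain v where v: "v \<in> K" "\<tau> v \<preceq> \<tau> w" "\<And>u. u \<in> K \<Longrightarrow> \<tau> u \<preceq> \<tau> v \<Longrightarrow> \<tau> u = \<tau> v"
    using minimal_label_in_compact[OF K(1,3)] by blast
  have P: "\<tau> v \<in> P" using v K openin_subset label_in by blast
  have "separated_in P lt (\<tau> v)" by (rule separated_of_minimal_label[OF R K(2) v(1,3)])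
  then have "openin W {w \<in> topspace W. \<tau> v \<preceq> \<tau> w}"
    using openin_labels_above_separated[OF R P] by blast
  then obtain A where "p_trim W P lt X (\<tau> v) A" "w \<in> A" "A \<subseteq> K"
    using trim_neighbourhood_by_gluing[OF P _ K(2,3) v(2,1)] by blast
  then show "\<exists>m\<in>P. \<exists>A. p_trim W P lt X m A \<and> w \<in> A \<and> A \<subseteq> U" using P K by blast
qed

lemma rank_partition_strongly_semi_trim:
  assumes R: "rank_partition W P lt X"
  shows "strongly_semi_trim W P lt X"
  unfolding strongly_semi_trim_def
proof (intro conjI ballI impI)
  have base: trim_base by (rule rank_partition_trim_base[OF R])
  show "neighbourhood_base_at w (trim W P lt X) W" if "w \<in> topspace W" for w
    using base that trim_base_iff by blast
  fix p assume p: "p \<in> trim_labels W P lt X"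
  then have pP: "p \<in> P" using trim_labels_subset by blast
  show "clean W P lt X w" if "w \<in> X p" for w
  proof -
    have w: "w \<in> topspace W" "\<tau> w = p" using that in_X_iff[OF pP] by auto
    then have "p \<in> trim_labels_at w"
      using separated_label_trim[OF base] trim_label_separated[OF R p] by blast
    then show ?thesis using that by (auto simp: clean_def trim_labels_at_def)
  qed
  \<comment> \<open>By its arbitrarily small \<open>p\<close>-trim neighbourhoods, \<^term>\<open>w\<close> is in the closure of \<^term>\<open>X p\<close>, and
    it is labelled above \<^term>\<open>p\<close>.\<close>
  fix w assume w: "w \<in> topspace W" and nb: "neighbourhood_base_at w (p_trim W P lt X p) W"
  have trims: "\<exists>A. p_trim W P lt X p A \<and> w \<in> A \<and> A \<subseteq> U" if "openin W U" "w \<in> U" for U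
    using nb that unfolding neighbourhood_base_at_def by (meson subsetD)
  have "\<tau> w \<preceq> p"
    using trims p_trim_iff[OF pP] by (intro label_le_of_meeting[OF w pP]) (metis le_refl subsetD)
  moreover have "p \<preceq> \<tau> w"
    using trims[OF openin_topspace w] p_trim_iff[OF pP] by blast
  ultimately show "w \<in> X p"
    using le_antisym label_in[OF w] pP in_X_iff[OF pP] w by blast
qed

section \<open>Compactness of trim labels in rank partitions\<close>

text \<open>
  A strictly increasing sequence of separated labels with a supremum is realised by points
  converging to a point that has the supremum as its label: the points are taken in nested trim
  sets, so that their limit is labelled above the whole sequence.
\<close>

lemma converging_points_with_increasing_labels:
  assumes R: "rank_partition W P lt X"
    and k: "range k \<subseteq> trim_labels W P lt X" "strictly_increasing lt k" "is_po_sup P lt (range k) s"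
  obtains x r y where "range x \<subseteq> topspace W" "limitin W x y sequentially" "\<tau> y = s"
    "strict_mono (r :: nat \<Rightarrow> nat)" "\<And>n. \<tau> (x n) = k (r n)"
proof -
  have kP: "k n \<in> P" for n using k(1) trim_labels_subset by blast
  have above: "openin W {w \<in> topspace W. k n \<preceq> \<tau> w}" for n
    using openin_labels_above_separated[OF R kP] trim_label_separated[OF R] k(1) by blast
  have "\<exists>A. \<forall>n. p_trim W P lt X (k n) (A n) \<and> A (Suc n) \<subseteq> A n"
  proof (rule dependent_nat_choice)
    show "\<exists>A. p_trim W P lt X (k 0) A" using k(1) by (auto simp: trim_labels_def)
    fix A n assume A: "p_trim W P lt X (k n) A"
    have step: "k n \<preceq> k (Suc n)" using strictly_increasing_less[OF k(2)] by blast
    obtain u where u: "u \<in> A" "\<tau> u = k n" using A p_trim_iff[OF kP] by blast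
    obtain v where v: "v \<in> A" "\<tau> v = k (Suc n)"
      using open_meets_larger[OF p_trim_open[OF A] u(1) _ kP] u(2) step by metis
    obtain B where "p_trim W P lt X (k (Suc n)) B" "B \<subseteq> A"
      using trim_neighbourhood_by_gluing[OF kP above p_trim_open[OF A] v(1) _ v] v(2) le_refl
      by metis
    then show "\<exists>B. p_trim W P lt X (k (Suc n)) B \<and> B \<subseteq> A" by blast
  qed
  then obtain A where A: "\<And>n. p_trim W P lt X (k n) (A n)" and nested: "\<And>n. A (Suc n) \<subseteq> A n"
    by blast
  have dec: "decseq A" using nested by (simp add: decseq_Suc_iff)
  have "\<forall>n. \<exists>v. v \<in> A n \<and> \<tau> v = k n" using A p_trim_iff[OF kP] by blast
  then obtain x where x: "\<And>n. x n \<in> A n" "\<And>n. \<tau> (x n) = k n" by metis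
  have compact: "compactin W (A n)" for n using A by (simp add: p_trim_def)
  have xA: "x n \<in> A m" if "m \<le> n" for m n using decseqD[OF dec that] x(1) by blast
  have AW: "A n \<subseteq> topspace W" for n using compact compactin_subset_topspace by blast
  obtain r :: "nat \<Rightarrow> nat" and y where r: "strict_mono r" and lim: "limitin W (\<lambda>n. x (r n)) y sequentially"
    using convergent_subsequence[OF compact, of x 0] xA by blast
  have rng: "range (\<lambda>n. x (r n)) \<subseteq> topspace W" using x(1) AW by blast
  have yW: "y \<in> topspace W" using lim limitin_topspace by metis
  have "k n \<preceq> \<tau> y" for n
  proof -
    have "y \<in> A n"
    proof (rule limitin_closedin[OF lim compact_open_imp_closed[OF compact]])
      show "\<forall>\<^sub>F i in sequentially. x (r i) \<in> A n"
        using eventually_ge_at_top[of n]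
        by eventually_elim (meson r seq_suble order_trans xA)
    qed simp
    then show ?thesis using A p_trim_iff[OF kP] by blast
  qed
  then have "s \<preceq> \<tau> y" using k(3) label_in[OF yW] unfolding sup_iff by blast
  moreover have sP: "s \<in> P" using k(3) by (simp add: sup_iff)
  moreover have "\<tau> y \<preceq> s"
    using limit_label_le[OF lim rng _ sP] k(3) x(2) unfolding sup_iff by simp
  ultimately have "\<tau> y = s" using le_antisym label_in[OF yW] by blast
  with rng lim show thesis using that[of "\<lambda>n. x (r n)" y r] r x(2) by blast
qed

text \<open>
  The trim labels in an ideal are again directed, with the same supremum, and there are only
  countably many of them. If they do not contain the supremum, an increasing cofinal sequence in
  them is realised by converging points, and the first rank condition puts \<^term>\<open>p\<close> below one
  of its terms.
\<close>

lemma rank_partition_trim_label_compact: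
  assumes R: "rank_partition W P lt X" and p: "p \<in> trim_labels W P lt X"
  shows "po_compact P lt p"
  unfolding po_compact_def le_def[symmetric]
proof (intro allI impI)
  have base: trim_base by (rule rank_partition_trim_base[OF R])
  have pP: "p \<in> P" using p trim_labels_subset by blast
  fix J s assume "po_ideal P lt J \<and> is_po_sup P lt J s \<and> p \<preceq> s"
  then have J: "J \<subseteq> P" "J \<noteq> {}" "\<forall>x\<in>J. \<forall>y\<in>P. y \<preceq> x \<longrightarrow> y \<in> J" "\<forall>x\<in>J. \<forall>y\<in>J. \<exists>z\<in>J. x \<preceq> z \<and> y \<preceq> z"
    and s: "is_po_sup P lt J s" and ps: "p \<preceq> s"
    unfolding ideal_iff by blast+
  have sP: "s \<in> P" using s by (simp add: sup_iff)
  define K where "K = J \<inter> trim_labels W P lt X"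
  have KP: "K \<subseteq> P" using J(1) by (auto simp: K_def)
  have at: "trim_labels_at w \<subseteq> K" if w: "w \<in> topspace W" "\<tau> w \<in> J" for w
  proof
    fix m assume m: "m \<in> trim_labels_at w"
    then have "m \<preceq> \<tau> w" using sup_trim_labels_at[OF base w(1)] by (simp add: sup_iff)
    then show "m \<in> K" using m J(3) w(2) trim_labels_at_subset trim_labels_subset unfolding K_def by blast
  qed
  have K_dir: "\<exists>c\<in>K. a \<preceq> c \<and> b \<preceq> c" if a: "a \<in> K" and b: "b \<in> K" for a b
  proof -
    obtain z where z: "z \<in> J" "a \<preceq> z" "b \<preceq> z" using J(4) a b unfolding K_def by blast
    obtain w where w: "w \<in> topspace W" "\<tau> w = z" using z J(1) point_with_label by blast
    have "openin W {w \<in> topspace W. q \<preceq> \<tau> w}" if "q \<in> K" for q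
      using that openin_labels_above_separated[OF R] trim_label_separated[OF R] KP
      unfolding K_def by blast
    then have "openin W ({w \<in> topspace W. a \<preceq> \<tau> w} \<inter> {w \<in> topspace W. b \<preceq> \<tau> w})"
      using a b by blast
    moreover have "w \<in> {w \<in> topspace W. a \<preceq> \<tau> w} \<inter> {w \<in> topspace W. b \<preceq> \<tau> w}" using w z by simp
    ultimately obtain c C where C: "c \<in> P" "p_trim W P lt X c C" "w \<in> C"
      "C \<subseteq> {w \<in> topspace W. a \<preceq> \<tau> w} \<inter> {w \<in> topspace W. b \<preceq> \<tau> w}"
      using base unfolding trim_base_def by meson
    then have "a \<preceq> c" "b \<preceq> c" using p_trim_iff[OF C(1)] by blast+
    moreover have "c \<in> K" using at[OF w(1)] w(2) z(1) C by (auto simp: trim_labels_at_def)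
    ultimately show ?thesis by blast
  qed
  have K_sup: "is_po_sup P lt K s"
    unfolding sup_iff
  proof (intro conjI ballI impI)
    show "x \<preceq> s" if "x \<in> K" for x using that s by (simp add: K_def sup_iff)
    fix u assume u: "u \<in> P" "\<forall>x\<in>K. x \<preceq> u"
    have "z \<preceq> u" if z: "z \<in> J" for z
    proof -
      obtain w where w: "w \<in> topspace W" "\<tau> w = z" using z J(1) point_with_label by blast
      then have "\<forall>x\<in>trim_labels_at w. x \<preceq> u" using at[OF w(1)] z u(2) by blast
      then show ?thesis using sup_trim_labels_at[OF base w(1)] u(1) w(2) by (simp add: sup_iff)
    qed
    then show "s \<preceq> u" using s u(1) by (simp add: sup_iff)
  qed (rule sP)
  show "p \<in> J"
  proof (cases "s \<in> K")
    case True
    then show ?thesis using J(3) ps pP by (auto simp: K_def)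
  next
    case False
    obtain w where "w \<in> topspace W" "\<tau> w \<in> J" using J(1,2) point_with_label by blast
    then have "K \<noteq> {}" using at trim_labels_at_nonempty[OF base] by blast
    moreover have "countable K"
      using countable_trim_labels by (simp add: K_def countable_Int2)
    ultimately obtain k where k: "range k \<subseteq> K" "strictly_increasing lt k" "is_po_sup P lt (range k) s"
      using increasing_sequence_of_countable_directed[OF KP _ _ _ K_sup False] K_dir by blast
    have kT: "range k \<subseteq> trim_labels W P lt X" using k(1) by (auto simp: K_def)
    obtain x r y where x: "range x \<subseteq> topspace W" "limitin W x y sequentially" "\<tau> y = s"
      "strict_mono (r :: nat \<Rightarrow> nat)" "\<And>n. \<tau> (x n) = k (r n)"
      using converging_points_with_increasing_labels[OF R kT k(2,3)] by blast
    have "strictly_increasing lt (\<lambda>n. \<tau> (x n))"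
      using strictly_increasing_subseq[OF k(2) x(4)] x(5) by simp
    then have "\<forall>\<^sub>F n in sequentially. p \<preceq> \<tau> (x n)"
      using R trim_label_separated[OF R p] x(1-3) ps pP unfolding rank_partition_iff by blast
    then obtain n where "p \<preceq> k (r n)" using x(5) by (auto simp: eventually_sequentially)
    then show ?thesis using J(3) k(1) pP unfolding K_def by blast
  qed
qed

section \<open>Strongly semi-trim partitions with compact trim labels\<close>

text \<open>
  The lower closure of the trim labels at \<^term>\<open>w\<close> is an ideal with supremum \<^term>\<open>\<tau> w\<close>. If
  \<^term>\<open>q\<close> is compact and below \<^term>\<open>\<tau> w\<close>, it therefore lies below the least label of some trim
  neighbourhood of \<^term>\<open>w\<close>.
\<close>

lemma openin_labels_above_compact:
  assumes base: trim_base and q: "q \<in> P" "po_compact P lt q"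
  shows "openin W {w \<in> topspace W. q \<preceq> \<tau> w}"
proof (subst openin_subopen, intro ballI)
  fix w assume "w \<in> {w \<in> topspace W. q \<preceq> \<tau> w}"
  then have w: "w \<in> topspace W" "q \<preceq> \<tau> w" by auto
  define J where "J = {x \<in> P. \<exists>m\<in>trim_labels_at w. x \<preceq> m}"
  have atP: "trim_labels_at w \<subseteq> P" using trim_labels_at_subset trim_labels_subset by blast
  have sub: "trim_labels_at w \<subseteq> J" using atP le_refl unfolding J_def by blast
  have "po_ideal P lt J"
    unfolding ideal_iff
  proof (intro conjI ballI impI)
    show "J \<noteq> {}" using sub trim_labels_at_nonempty[OF base w(1)] by blast
    fix x assume "x \<in> J"
    then obtain m where m: "m \<in> trim_labels_at w" "m \<in> P" "x \<preceq> m" "x \<in> P" using atP unfolding J_def by blast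
    show "y \<in> J" if "y \<in> P" "y \<preceq> x" for y
      using m le_trans[OF that(2) m(3) that(1) m(4,2)] that(1) unfolding J_def by blast
    fix y assume "y \<in> J"
    then obtain n where n: "n \<in> trim_labels_at w" "n \<in> P" "y \<preceq> n" "y \<in> P" using atP unfolding J_def by blast
    obtain c where c: "c \<in> trim_labels_at w" "m \<preceq> c" "n \<preceq> c"
      using trim_labels_at_directed[OF base m(1) n(1)] by blast
    then have cP: "c \<in> P" using atP by blast
    have "x \<preceq> c" "y \<preceq> c"
      using le_trans[OF m(3) c(2) m(4,2) cP] le_trans[OF n(3) c(3) n(4,2) cP] by auto
    then show "\<exists>z\<in>J. x \<preceq> z \<and> y \<preceq> z" using c(1) sub by blast
  qed (auto simp: J_def)
  moreover have "is_po_sup P lt J (\<tau> w)"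
    unfolding sup_iff
  proof (intro conjI ballI impI)
    have sup: "is_po_sup P lt (trim_labels_at w) (\<tau> w)" by (rule sup_trim_labels_at[OF base w(1)])
    show wP: "\<tau> w \<in> P" by (rule label_in[OF w(1)])
    show "x \<preceq> \<tau> w" if "x \<in> J" for x
      using that sup atP le_trans[of x _ "\<tau> w"] wP unfolding J_def sup_iff by blast
    show "\<tau> w \<preceq> u" if "u \<in> P" "\<forall>x\<in>J. x \<preceq> u" for u
      using that sup sub unfolding sup_iff by blast
  qed
  ultimately have "q \<in> J" using q(2) w(2) unfolding po_compact_def le_def by blast
  then obtain m A where m: "m \<in> P" "q \<preceq> m" and A: "p_trim W P lt X m A" "w \<in> A"
    unfolding J_def trim_labels_at_def by blast
  have AW: "A \<subseteq> topspace W" using A(1) p_trim_open openin_subset by blast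
  have "q \<preceq> \<tau> v" if "v \<in> A" for v
    using le_trans[OF m(2) _ q(1) m(1)] that A(1) p_trim_iff[OF m(1)] label_in AW by blast
  then have "A \<subseteq> {w \<in> topspace W. q \<preceq> \<tau> w}" using AW by blast
  then show "\<exists>T. openin W T \<and> w \<in> T \<and> T \<subseteq> {w \<in> topspace W. q \<preceq> \<tau> w}"
    using A p_trim_open by blast
qed

text \<open>
  Separated labels are trim labels, hence compact, so the points above them form open sets and
  absorb every sequence that tends into them. Conversely compact labels are separated, so around a
  point whose label is not separated all trim sets have strictly smaller least labels.
\<close>

lemma rank_partition_of_compact_trim_labels:
  assumes base: trim_base and compact: "\<forall>p\<in>trim_labels W P lt X. po_compact P lt p"
  shows "rank_partition W P lt X"
  unfolding rank_partition_iff
proof (intro conjI ballI allI impI)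
  fix q x y
  assume q: "q \<in> P" and hyp: "separated_in P lt q \<and> range x \<subseteq> topspace W \<and> limitin W x y sequentially \<and>
    q \<preceq> \<tau> y \<and> (pairwise_incomparable lt (\<lambda>k. \<tau> (x k)) \<or> strictly_increasing lt (\<lambda>k. \<tau> (x k)))"
  obtain w where "w \<in> topspace W" "\<tau> w = q" using point_with_label[OF q] by blast
  then have "q \<in> trim_labels W P lt X"
    using separated_label_trim[OF base] hyp trim_labels_at_subset by blast
  then have "openin W {w \<in> topspace W. q \<preceq> \<tau> w}"
    using openin_labels_above_compact[OF base q] compact by blast
  moreover have "y \<in> {w \<in> topspace W. q \<preceq> \<tau> w}" using hyp limitin_topspace by fastforce
  ultimately have "\<forall>\<^sub>F k in sequentially. x k \<in> {w \<in> topspace W. q \<preceq> \<tau> w}"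
    using hyp unfolding limitin_def by blast
  then show "\<forall>\<^sub>F k in sequentially. q \<preceq> \<tau> (x k)" by eventually_elim blast
next
  fix y assume y: "y \<in> topspace W" and nsep: "\<not> separated_in P lt (\<tau> y)"
  have less: "\<exists>v\<in>U. v \<in> topspace W \<and> po_less lt (\<tau> v) (\<tau> y)" if U: "openin W U" "y \<in> U" for U
  proof -
    obtain m A where A: "m \<in> P" "p_trim W P lt X m A" "y \<in> A" "A \<subseteq> U"
      using base U unfolding trim_base_def by meson
    then have "m \<in> trim_labels W P lt X" by (auto simp: trim_labels_def)
    then have "m \<noteq> \<tau> y" using nsep compact compact_imp_separated[OF A(1)] by blast
    moreover obtain v where "v \<in> A" "\<tau> v = m" "m \<preceq> \<tau> y" using A p_trim_iff[OF A(1)] by blast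
    ultimately show ?thesis using A(4) openin_subset[OF U(1)] by (auto simp: po_less_iff)
  qed
  obtain x where "\<And>n. x n \<in> topspace W \<and> po_less lt (\<tau> (x n)) (\<tau> y)" "range x \<subseteq> topspace W"
    "limitin W x y sequentially"
    using limit_of_meeting_neighbourhoods[OF y less] by blast
  then show "\<exists>x. range x \<subseteq> topspace W \<and> limitin W x y sequentially \<and> (\<forall>k. po_less lt (\<tau> (x k)) (\<tau> y))"
    by blast
qed

end

section \<open>Characterisation of rank partitions\<close>

theorem theorem4p12:
  fixes W :: "'w topology" and P :: "'p set"
    and lt :: "'p \<Rightarrow> 'p \<Rightarrow> bool" and X :: "'p \<Rightarrow> 'w set"
  assumes "omega_Stone_space W"
    and "po_system P lt"
    and "complete_partition W P lt X"
  shows "rank_partition W P lt X \<longleftrightarrow>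
    strongly_semi_trim W P lt X \<and> (\<forall>p\<in>trim_labels W P lt X. po_compact P lt p)"
proof -
  interpret po_partition W P lt X
    using assms by unfold_locales
  show ?thesis
  proof
    assume "rank_partition W P lt X"
    then show "strongly_semi_trim W P lt X \<and> (\<forall>p\<in>trim_labels W P lt X. po_compact P lt p)"
      using rank_partition_strongly_semi_trim rank_partition_trim_label_compact by blast
  next
    assume "strongly_semi_trim W P lt X \<and> (\<forall>p\<in>trim_labels W P lt X. po_compact P lt p)"
    then show "rank_partition W P lt X"
      using rank_partition_of_compact_trim_labels trim_base_iff
      unfolding strongly_semi_trim_def by blast
  qed
qed

end
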